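(* As $n\to\infty$, the random variable $\operatorname{adj}$, evaluated on a uniformly random permutation of length $n$, converges in distribution to $\operatorname{Po}(1)$.
   Context: For a permutation $\sigma=\sigma_1\cdots\sigma_n$ of $\{1,\dots,n\}$, $\operatorname{adj}(\sigma)$ is the number of indices $i\in\{1,\dots,n-1\}$ with $\sigma_i=\sigma_{i+1}+1$. $\operatorname{Po}(\lambda)$ is the Poisson distribution with parameter $\lambda>0$: $\mathbb P(X=k)=\lambda^k e^{-\lambda}/k!$ for $k=0,1,2,\dots$. *)

theory Defs
  imports "HOL-Probability.Probability" "HOL-Combinatorics.Permutations"
begin

text \<open>A permutation \<open>\<sigma>\<^sub>1\<dots>\<sigma>\<^sub>n\<close> of \<open>{1..n}\<close> is a function \<open>\<sigma>\<close> with \<open>\<sigma> permutes {1..n}\<close>; since such a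
  function is defined on all of \<^typ>\<open>nat\<close>, the length \<open>n\<close> has to be an explicit argument of \<open>adj\<close>.\<close>

definition adj :: "nat \<Rightarrow> (nat \<Rightarrow> nat) \<Rightarrow> nat" where
  "adj n \<sigma> = card {i \<in> {1..<n}. \<sigma> i = \<sigma> (i + 1) + 1}"

end

theory Submission
  imports Defs
begin

text \<open>
  By Levy's continuity theorem it suffices that the characteristic functions converge, that is,
  that the average of \<open>z ^ adj \<sigma>\<close> over all permutations \<open>\<sigma>\<close> of \<open>{1..n}\<close> tends to \<open>exp (z - 1)\<close>,
  the probability generating function of the Poisson law, for \<open>z\<close> on the unit circle.

  Put \<open>w = z - 1\<close> and let \<open>A \<sigma>\<close> be the set of positions counted by \<open>adj\<close>. Then
  \<open>z ^ adj \<sigma> = (1 + w) ^ card (A \<sigma>)\<close> is the sum of \<open>w ^ card S\<close> over all \<open>S \<subseteq> A \<sigma>\<close>. After exchanging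
  the sums one has to count the permutations with \<open>S \<subseteq> A \<sigma>\<close> for a fixed \<open>S \<subseteq> {1..<n}\<close>. There are
  \<open>(n - card S)!\<close> of them, since each prescribed adjacency glues two neighbouring entries with
  neighbouring values into one (\<open>card_permutes_adj_on\<close>). Hence the average equals
  \[\sum_{k<n} {n-1 \choose k} \frac{(n-k)!}{n!} w^k = \sum_{k<n} \frac{n-k}{n} \frac{w^k}{k!}.\]
  Writing \<open>(n - k) / n = 1 - k / n\<close> turns this into a partial sum of the exponential series minus
  \<open>w / n\<close> times the preceding partial sum (\<open>average_power_adj\<close>), so the limit is \<open>exp w\<close>.
\<close>

section \<open>Gluing the two entries of an adjacency\<close>

text \<open>
  \<open>raise v\<close> is the increasing bijection from the naturals onto the naturals other than \<open>v\<close>, and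
  \<open>lower v\<close> is its inverse. They make room for, or close the gap left by, a position or a value.
\<close>

definition raise :: "nat \<Rightarrow> nat \<Rightarrow> nat" where
  "raise v x = (if x < v then x else Suc x)"

definition lower :: "nat \<Rightarrow> nat \<Rightarrow> nat" where
  "lower v x = (if x \<le> v then x else x - 1)"

lemma lower_raise [simp]: "lower v (raise v x) = x"
  by (auto simp: raise_def lower_def)

lemma raise_lower [simp]: "x \<noteq> v \<Longrightarrow> raise v (lower v x) = x"
  by (auto simp: raise_def lower_def)

lemma raise_neq [simp]: "raise v x \<noteq> v"
  by (auto simp: raise_def)

lemma raise_eq_iff [simp]: "raise v x = raise v y \<longleftrightarrow> x = y"
  by (auto simp: raise_def)

text \<open>
  In one-line notation, \<open>split_entry i \<tau>\<close> replaces the entry \<open>v\<close> at position \<open>i\<close> by the two entries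
  \<open>v + 1, v\<close> and increases every larger entry by one; \<open>merge_entries i\<close> deletes the entry at position
  \<open>i + 1\<close> and standardizes. Both act on functions on all naturals, so the entries beyond the
  length are shifted as well; they remain fixed points because position and value shift together.
\<close>

definition split_entry :: "nat \<Rightarrow> (nat \<Rightarrow> nat) \<Rightarrow> nat \<Rightarrow> nat" where
  "split_entry i \<tau> = (\<lambda>j. if j = Suc i then \<tau> i else raise (\<tau> i) (\<tau> (lower (Suc i) j)))"

definition merge_entries :: "nat \<Rightarrow> (nat \<Rightarrow> nat) \<Rightarrow> nat \<Rightarrow> nat" where
  "merge_entries i \<sigma> = (\<lambda>j. lower (\<sigma> (Suc i)) (\<sigma> (raise (Suc i) j)))"

lemma lower_eq_iff: "x \<noteq> v \<Longrightarrow> y \<noteq> v \<Longrightarrow> lower v x = lower v y \<longleftrightarrow> x = y"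
  using raise_lower by metis

lemma split_entry_permutes:
  assumes \<tau>: "\<tau> permutes {1..n}" and i: "i \<in> {1..n}"
  shows "split_entry i \<tau> permutes {1..Suc n}"
proof (rule inj_imp_permutes)
  have inj: "\<tau> x = \<tau> y \<longleftrightarrow> x = y" for x y
    using permutes_inj[OF \<tau>] by (auto dest: injD)
  show "inj_on (split_entry i \<tau>) {1..Suc n}"
    by (rule inj_onI)
      (auto simp: split_entry_def inj lower_eq_iff raise_neq[symmetric] split: if_splits)
  have v: "\<tau> i \<in> {1..n}" using permutes_in_image[OF \<tau>] i by blast
  show "split_entry i \<tau> j \<in> {1..Suc n}" if "j \<in> {1..Suc n}" for j
  proof (cases "j = Suc i")
    case False
    have "lower (Suc i) j \<in> {1..n}" using that i False by (auto simp: lower_def)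
    then have "\<tau> (lower (Suc i) j) \<in> {1..n}" using permutes_in_image[OF \<tau>] by blast
    then show ?thesis using False by (auto simp: split_entry_def raise_def)
  qed (use v in \<open>auto simp: split_entry_def\<close>)
  show "split_entry i \<tau> j = j" if "j \<notin> {1..Suc n}" for j
  proof -
    have "lower (Suc i) j \<notin> {1..n}" "j \<noteq> Suc i" using that i by (auto simp: lower_def)
    then have "split_entry i \<tau> j = raise (\<tau> i) (lower (Suc i) j)"
      using permutes_not_in[OF \<tau>] by (simp add: split_entry_def)
    then show ?thesis using that i v by (auto simp: lower_def raise_def)
  qed
qed simp

lemma merge_entries_permutes:
  assumes \<sigma>: "\<sigma> permutes {1..Suc n}" and i: "i \<in> {1..n}"
  shows "merge_entries i \<sigma> permutes {1..n}"
proof (rule inj_imp_permutes)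
  have inj: "\<sigma> x = \<sigma> y \<longleftrightarrow> x = y" for x y
    using permutes_inj[OF \<sigma>] by (auto dest: injD)
  show "inj_on (merge_entries i \<sigma>) {1..n}"
    by (rule inj_onI) (auto simp: merge_entries_def lower_eq_iff inj)
  have v: "\<sigma> (Suc i) \<in> {1..Suc n}" using permutes_in_image[OF \<sigma>, of "Suc i"] i by auto
  show "merge_entries i \<sigma> j \<in> {1..n}" if "j \<in> {1..n}" for j
  proof -
    have "raise (Suc i) j \<in> {1..Suc n}" using that by (auto simp: raise_def)
    then have "\<sigma> (raise (Suc i) j) \<in> {1..Suc n}" using permutes_in_image[OF \<sigma>] by blast
    moreover have "\<sigma> (raise (Suc i) j) \<noteq> \<sigma> (Suc i)" by (simp add: inj)
    ultimately show ?thesis using v by (auto simp: merge_entries_def lower_def)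
  qed
  show "merge_entries i \<sigma> j = j" if "j \<notin> {1..n}" for j
  proof -
    have "raise (Suc i) j \<notin> {1..Suc n}" using that i by (auto simp: raise_def)
    then have "merge_entries i \<sigma> j = lower (\<sigma> (Suc i)) (raise (Suc i) j)"
      using permutes_not_in[OF \<sigma>] by (simp add: merge_entries_def)
    then show ?thesis using that i v by (auto simp: lower_def raise_def)
  qed
qed simp

lemma merge_split_entry: "merge_entries i (split_entry i \<tau>) = \<tau>"
  by (simp add: merge_entries_def split_entry_def fun_eq_iff)

lemma split_merge_entries:
  assumes \<sigma>: "inj \<sigma>" and adj: "\<sigma> i = Suc (\<sigma> (Suc i))"
  shows "split_entry i (merge_entries i \<sigma>) = \<sigma>"
proof
  fix j
  have v: "merge_entries i \<sigma> i = \<sigma> (Suc i)"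
    using adj by (simp add: merge_entries_def raise_def lower_def)
  show "split_entry i (merge_entries i \<sigma>) j = \<sigma> j"
  proof (cases "j = Suc i")
    case False
    moreover have "\<sigma> j \<noteq> \<sigma> (Suc i)" using False \<sigma> by (auto dest: injD)
    ultimately show ?thesis unfolding split_entry_def v by (simp add: merge_entries_def)
  qed (simp add: split_entry_def v)
qed

lemma split_entry_adj: "split_entry i \<tau> i = Suc (split_entry i \<tau> (Suc i))"
  by (simp add: split_entry_def lower_def raise_def)

text \<open>
  The shift of values separates \<open>x\<close> from \<open>x + 1\<close> only if \<open>x + 1\<close> is the value at the split position
  \<open>i\<close>, and in \<open>\<tau>\<close> that value occurs at no position \<open>j < i\<close>. If \<open>j + 1 = i\<close>, the
  new right neighbour carries the upper copy of the split value, which is also the value that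
  \<open>raise\<close> assigns to it.
\<close>

lemma split_entry_adj_before:
  assumes "inj \<tau>" and "j < i"
  shows "split_entry i \<tau> j = Suc (split_entry i \<tau> (Suc j)) \<longleftrightarrow> \<tau> j = Suc (\<tau> (Suc j))"
proof -
  have "\<tau> j \<noteq> \<tau> i" using assms by (auto dest: injD)
  then show ?thesis
    using \<open>j < i\<close> by (auto simp: split_entry_def lower_def raise_def)
qed

text \<open>
  Merging at the largest element \<open>i\<close> of \<open>S\<close> removes one position and one prescribed adjacency. Taking
  the largest element keeps the remaining conditions in place: they concern only positions up to
  \<open>i\<close>, whose numbering does not change.
\<close>

lemma card_permutes_adj_on:
  assumes "S \<subseteq> {1..<n}"
  shows "card {\<sigma>. \<sigma> permutes {1..n} \<and> (\<forall>i\<in>S. \<sigma> i = Suc (\<sigma> (Suc i)))} = fact (n - card S)"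
proof -
  have "finite S" using assms finite_subset by blast
  then show ?thesis using assms
  proof (induction S arbitrary: n rule: finite_linorder_max_induct)
    case empty
    then show ?case by (simp add: card_permutations)
  next
    case (insert i S)
    then obtain m where n: "n = Suc m" and i: "i \<in> {1..m}" by (cases n) auto
    have S: "S \<subseteq> {1..<m}" using insert.hyps insert.prems i by force
    let ?P = "\<lambda>n S. {\<sigma>. \<sigma> permutes {1..n} \<and> (\<forall>i\<in>S. \<sigma> i = Suc (\<sigma> (Suc i)))}"
    have "bij_betw (split_entry i) (?P m S) (?P n (insert i S))"
    proof (rule bij_betw_byWitness[where f' = "merge_entries i"])
      show "\<forall>\<tau>\<in>?P m S. merge_entries i (split_entry i \<tau>) = \<tau>"
        by (simp add: merge_split_entry)
      show "\<forall>\<sigma>\<in>?P n (insert i S). split_entry i (merge_entries i \<sigma>) = \<sigma>"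
        by (auto intro!: split_merge_entries dest: permutes_inj)
      show "split_entry i ` ?P m S \<subseteq> ?P n (insert i S)"
      proof (safe, goal_cases)
        case (1 _ \<tau>)
        then show ?case using split_entry_permutes[OF _ i] n by simp
      next
        case (2 _ \<tau>)
        then show ?case by (simp add: split_entry_adj)
      next
        case (3 _ \<tau> j)
        then show ?case
          using insert.hyps by (subst split_entry_adj_before) (auto dest: permutes_inj)
      qed
      show "merge_entries i ` ?P n (insert i S) \<subseteq> ?P m S"
      proof (rule image_subsetI)
        fix \<sigma> assume \<sigma>: "\<sigma> \<in> ?P n (insert i S)"
        define \<tau> where "\<tau> = merge_entries i \<sigma>"
        have \<tau>: "\<tau> permutes {1..m}"
          unfolding \<tau>_def using \<sigma> n by (intro merge_entries_permutes i) auto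
        have "\<sigma> = split_entry i \<tau>"
          unfolding \<tau>_def using \<sigma> by (auto intro!: split_merge_entries[symmetric] dest: permutes_inj)
        then have "\<forall>j\<in>S. \<tau> j = Suc (\<tau> (Suc j))"
          using \<sigma> split_entry_adj_before[OF permutes_inj[OF \<tau>]] insert.hyps by auto
        then show "merge_entries i \<sigma> \<in> ?P m S" using \<tau> \<tau>_def by simp
      qed
    qed
    then have "card (?P n (insert i S)) = card (?P m S)" by (rule bij_betw_same_card[symmetric])
    also have "\<dots> = fact (m - card S)" by (rule insert.IH[OF S])
    also have "m - card S = n - card (insert i S)"
      using insert.hyps n by (subst card_insert_disjoint) auto
    finally show ?case .
  qed
qed

section \<open>The generating function of the number of adjacencies\<close>

lemma power_one_plus_eq_sum_Pow:
  fixes w :: "'a :: comm_ring_1"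
  assumes "finite A"
  shows "(1 + w) ^ card A = (\<Sum>S\<in>Pow A. w ^ card S)"
  using prod_add[OF assms, of "\<lambda>_. w" "\<lambda>_. 1"] by (simp add: add.commute)

lemma sum_Pow_card:
  fixes f :: "nat \<Rightarrow> 'a :: comm_semiring_1"
  assumes "finite A"
  shows "(\<Sum>S\<in>Pow A. f (card S)) = (\<Sum>k\<le>card A. of_nat (card A choose k) * f k)"
proof -
  have "(\<Sum>S\<in>Pow A. f (card S))
      = (\<Sum>k\<le>card A. \<Sum>S\<in>{S \<in> Pow A. card S = k}. f (card S))"
    by (rule sum.group[symmetric]) (use assms card_mono in auto)
  also have "\<dots> = (\<Sum>k\<le>card A. of_nat (card A choose k) * f k)"
    using n_subsets[OF assms] by (intro sum.cong refl) simp
  finally show ?thesis .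
qed

text \<open>
  The coefficient of \<open>w ^ k\<close> is \<open>n!\<close> times the \<open>k\<close>-th binomial moment of \<open>adj\<close>, that is, the number of
  pairs of a permutation and a set of \<open>k\<close> of its adjacencies.
\<close>

lemma sum_permutes_power_adj:
  fixes w :: "'a :: {comm_ring_1, semiring_char_0}"
  shows "(\<Sum>\<sigma> | \<sigma> permutes {1..n}. (1 + w) ^ adj n \<sigma>)
       = (\<Sum>k\<le>n - 1. of_nat ((n - 1) choose k) * (w ^ k * fact (n - k)))"
proof -
  let ?\<A> = "\<lambda>\<sigma>. {i \<in> {1..<n}. \<sigma> i = Suc (\<sigma> (Suc i))}"
  have "(\<Sum>\<sigma> | \<sigma> permutes {1..n}. (1 + w) ^ adj n \<sigma>)
      = (\<Sum>\<sigma> | \<sigma> permutes {1..n}. \<Sum>S\<in>Pow (?\<A> \<sigma>). w ^ card S)"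
    by (simp add: adj_def power_one_plus_eq_sum_Pow)
  also have "\<dots> = (\<Sum>\<sigma> | \<sigma> permutes {1..n}. \<Sum>S | S \<in> Pow {1..<n} \<and> S \<subseteq> ?\<A> \<sigma>. w ^ card S)"
    by (intro sum.cong refl) auto
  also have "\<dots> = (\<Sum>S\<in>Pow {1..<n}. \<Sum>\<sigma> | \<sigma> \<in> {\<sigma>. \<sigma> permutes {1..n}} \<and> S \<subseteq> ?\<A> \<sigma>. w ^ card S)"
    by (rule sum.swap_restrict) (auto simp: finite_permutations)
  also have "\<dots> = (\<Sum>S\<in>Pow {1..<n}. w ^ card S * fact (n - card S))"
  proof (intro sum.cong refl)
    fix S assume S: "S \<in> Pow {1..<n}"
    have "{\<sigma>. \<sigma> \<in> {\<sigma>. \<sigma> permutes {1..n}} \<and> S \<subseteq> ?\<A> \<sigma>}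
        = {\<sigma>. \<sigma> permutes {1..n} \<and> (\<forall>i\<in>S. \<sigma> i = Suc (\<sigma> (Suc i)))}"
      using S by auto
    then show "(\<Sum>\<sigma> | \<sigma> \<in> {\<sigma>. \<sigma> permutes {1..n}} \<and> S \<subseteq> ?\<A> \<sigma>. w ^ card S)
        = w ^ card S * fact (n - card S)"
      using card_permutes_adj_on[of S n] S by (simp add: mult.commute)
  qed
  also have "\<dots> = (\<Sum>k\<le>n - 1. of_nat ((n - 1) choose k) * (w ^ k * fact (n - k)))"
    using sum_Pow_card[of "{1..<n}" "\<lambda>k. w ^ k * fact (n - k)"] by simp
  finally show ?thesis .
qed

text \<open>
  The binomial coefficient cancels against the factorials to leave \<open>(n - k) / n\<close> times
  \<open>w ^ k / k!\<close>, and the part \<open>k / n\<close> of this factor shifts the index of the exponential series by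
  one. This closed form makes the limit immediate.
\<close>

lemma average_power_adj:
  fixes w :: "'a :: field_char_0"
  assumes "n > 0"
  shows "(\<Sum>\<sigma> | \<sigma> permutes {1..n}. (1 + w) ^ adj n \<sigma>) / fact n
       = (\<Sum>k<Suc n. w ^ k / fact k) - w / of_nat n * (\<Sum>k<n. w ^ k / fact k)"
proof -
  obtain m where n: "n = Suc m" using assms by (cases n) auto
  have "of_nat (m choose k) * (w ^ k * fact (n - k)) / fact n
      = w ^ k / fact k - of_nat k / of_nat n * (w ^ k / fact k)" if "k \<le> m" for k
  proof -
    have "(fact m :: 'a) = of_nat (m choose k) * (fact k * fact (m - k))"
      using arg_cong[OF binomial_fact_lemma[OF that], of "of_nat :: nat \<Rightarrow> 'a"]
      by (simp add: mult_ac)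
    moreover have "(fact (n - k) :: 'a) = (of_nat n - of_nat k) * fact (m - k)"
      using that by (simp add: n Suc_diff_le of_nat_diff)
    moreover have "(fact n :: 'a) = of_nat n * fact m" by (simp add: n)
    moreover have "of_nat (m choose k) \<noteq> (0 :: 'a)" "of_nat n \<noteq> (0 :: 'a)"
      using that n by (auto simp del: of_nat_Suc)
    ultimately show ?thesis by (simp add: divide_simps) (simp add: algebra_simps)
  qed
  then have "(\<Sum>\<sigma> | \<sigma> permutes {1..n}. (1 + w) ^ adj n \<sigma>) / fact n
      = (\<Sum>k\<le>m. w ^ k / fact k - of_nat k / of_nat n * (w ^ k / fact k))"
    unfolding sum_permutes_power_adj sum_divide_distrib n by (intro sum.cong) auto
  \<comment> \<open>The added term \<open>k = n\<close> vanishes because of the factor \<open>1 - k / n\<close>.\<close>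
  also have "\<dots> = (\<Sum>k<Suc n. w ^ k / fact k - of_nat k / of_nat n * (w ^ k / fact k))"
    by (simp add: n lessThan_Suc_atMost del: of_nat_Suc)
  also have "\<dots> = (\<Sum>k<Suc n. w ^ k / fact k)
      - (\<Sum>k<Suc n. of_nat k / of_nat n * (w ^ k / fact k))"
    by (rule sum_subtractf)
  also have "(\<Sum>k<Suc n. of_nat k / of_nat n * (w ^ k / fact k))
      = (\<Sum>k<n. of_nat (Suc k) / of_nat n * (w ^ Suc k / fact (Suc k)))"
    by (subst sum.lessThan_Suc_shift) simp
  also have "\<dots> = (\<Sum>k<n. w / of_nat n * (w ^ k / fact k))"
    by (intro sum.cong refl) (simp add: divide_simps del: of_nat_Suc)
  finally show ?thesis by (simp add: sum_distrib_left)
qed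

lemma average_power_adj_tendsto:
  fixes z :: "'a :: {real_normed_field, banach}"
  shows "(\<lambda>n. (\<Sum>\<sigma> | \<sigma> permutes {1..n}. z ^ adj n \<sigma>) / fact n) \<longlonglongrightarrow> exp (z - 1)"
proof -
  define w where "w = z - 1"
  have E: "(\<lambda>n. \<Sum>k<n. w ^ k / fact k) \<longlonglongrightarrow> exp w"
    using exp_converges[of w] unfolding sums_def
    by (simp add: scaleR_conv_of_real divide_inverse mult.commute nonzero_of_real_inverse)
  have "(\<lambda>n. (\<Sum>k<Suc n. w ^ k / fact k) - w / of_nat n * (\<Sum>k<n. w ^ k / fact k))
      \<longlonglongrightarrow> exp w - 0 * exp w"
    by (intro tendsto_intros E filterlim_compose[OF E filterlim_Suc] lim_const_over_n)
  moreover have "eventually (\<lambda>n. (\<Sum>k<Suc n. w ^ k / fact k) - w / of_nat n * (\<Sum>k<n. w ^ k / fact k)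
      = (\<Sum>\<sigma> | \<sigma> permutes {1..n}. z ^ adj n \<sigma>) / fact n) sequentially"
    using eventually_gt_at_top[of 0]
    by eventually_elim (use average_power_adj[of _ w] in \<open>simp add: w_def\<close>)
  ultimately show ?thesis by (simp add: w_def tendsto_cong)
qed

section \<open>Characteristic functions and the Poisson limit\<close>

lemma iexp_mult_of_nat: "iexp (t * real k) = iexp t ^ k"
  by (simp add: exp_of_nat_mult[symmetric] mult_ac)

text \<open>
  For a variable with values in the naturals, the characteristic function is the probability
  generating function on the unit circle.
\<close>

lemma char_distr_real:
  "char (distr (measure_pmf p) borel (\<lambda>x. real (f x))) t
     = measure_pmf.expectation p (\<lambda>x. iexp t ^ f x)"
  unfolding char_def by (subst integral_distr) (auto simp: iexp_mult_of_nat simp del: of_real_mult)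

lemma expectation_poisson_power:
  fixes z :: complex
  assumes "rate > 0"
  shows "measure_pmf.expectation (poisson_pmf rate) (\<lambda>k. z ^ k) = exp (of_real rate * (z - 1))"
proof -
  let ?f = "\<lambda>k. pmf (poisson_pmf rate) k *\<^sub>R z ^ k"
  have eq: "?f k = exp (- of_real rate) * ((of_real rate * z) ^ k /\<^sub>R fact k)" for k
    using assms
    by (simp add: scaleR_conv_of_real power_mult_distrib exp_of_real[symmetric] divide_simps)
  have "integrable (count_space UNIV) ?f"
    unfolding integrable_count_space_nat_iff eq norm_mult
    by (intro summable_mult summable_norm_exp)
  then have "?f sums (\<integral>k. ?f k \<partial>count_space UNIV)"
    by (rule sums_integral_count_space_nat)
  moreover have "?f sums (exp (- of_real rate) * exp (of_real rate * z))"
    unfolding eq by (intro sums_mult exp_converges)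
  ultimately have "(\<integral>k. ?f k \<partial>count_space UNIV) = exp (- of_real rate) * exp (of_real rate * z)"
    by (rule sums_unique2)
  also have "\<dots> = exp (of_real rate * (z - 1))"
    by (simp add: exp_add[symmetric] algebra_simps)
  finally show ?thesis
    unfolding measure_pmf_eq_density by (subst integral_density) auto
qed

theorem theorem6p10:
  shows "weak_conv_m
    (\<lambda>n. distr (measure_pmf (pmf_of_set {\<sigma>. \<sigma> permutes {1..n}})) borel (\<lambda>\<sigma>. real (adj n \<sigma>)))
    (distr (measure_pmf (poisson_pmf 1)) borel real)"
proof (rule levy_continuity)
  fix t
  have "{\<sigma>. \<sigma> permutes {1..n}} \<noteq> {}" "finite {\<sigma>. \<sigma> permutes {1..n}}" for n :: nat
    by (auto intro: permutes_id finite_permutations)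
  then have "char (distr (measure_pmf (pmf_of_set {\<sigma>. \<sigma> permutes {1..n}})) borel
      (\<lambda>\<sigma>. real (adj n \<sigma>))) t
      = (\<Sum>\<sigma> | \<sigma> permutes {1..n}. iexp t ^ adj n \<sigma>) / fact n" for n
    unfolding char_distr_real
    by (subst integral_measure_pmf[where A = "{\<sigma>. \<sigma> permutes {1..n}}"])
      (auto simp: card_permutations sum_distrib_left scaleR_conv_of_real divide_inverse mult.commute)
  moreover have "char (distr (measure_pmf (poisson_pmf 1)) borel real) t = exp (iexp t - 1)"
    using char_distr_real[of "poisson_pmf 1" "\<lambda>k. k" t] by (simp add: expectation_poisson_power)
  ultimately show "(\<lambda>n. char (distr (measure_pmf (pmf_of_set {\<sigma>. \<sigma> permutes {1..n}})) borel
      (\<lambda>\<sigma>. real (adj n \<sigma>))) t) \<longlonglongrightarrow> char (distr (measure_pmf (poisson_pmf 1)) borel real) t"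
    using average_power_adj_tendsto[of "iexp t"] by simp
qed (auto intro!: prob_space.real_distribution_distr prob_space_measure_pmf)

end
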